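(* The poset $P$ defined in the context, equipped with its Scott topology, is not a sober space.
   Context: Countable means of cardinality at most $\aleph_0$ (finite sets included). For a set $M$, $[M]^\omega$ is the set of countably infinite subsets of $M$, $[M]^{\le\omega}$ the set of all countable subsets of $M$ (including finite sets and $\varnothing$), and $[M]^{<\omega}$ the set of finite subsets of $M$. The detector family. Fix a family $\mathcal A\subseteq[\mathbb R]^\omega$ of cardinality $\mathfrak c=|\mathbb R|$ that is almost disjoint ($A\cap B$ is finite for distinct $A,B\in\mathcal A$) and such that every uncountable $B\subseteq\mathbb R$ contains some $A\in\mathcal A$ as a subset (such a family exists in ZFC by a theorem of Komjáth). Let $2^{<\omega}$ be the set of finite binary sequences and $2^\omega$ the set of functions $\omega\to\{0,1\}$; for $\xi\in2^\omega$ let $\xi\upharpoonright n$ be its restriction to the first $n$ coordinates. For each $A\in\mathcal A$ fix an injection $e_A:2^{<\omega}\to A$, and for $\xi\in2^\omega$ put $A^\xi=\{e_A(\xi\upharpoonright n):n<\omega\}$. Fix a bijection $\beta:\mathbb R\to2^\omega$ and, for $p\in\mathbb R$, put $\mathcal S_p=\{A^{\beta(p)}\setminus\{p\}:A\in\mathcal A\}$. The topology $\tau$. For $p\in\mathbb R$, $S\in\mathcal S_p$ and finite $F\subseteq S$, let $K(p,S,F)=\{p\}\cup(S\setminus F)$. Let $\mathscr K=\{\mathbb R\}\cup\{\{x\}:x\in\mathbb R\}\cup\{K(p,S,F):p\in\mathbb R,\ S\in\mathcal S_p,\ F\in[S]^{<\omega}\}$, and let $\tau$ be the topology on $\mathbb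 R$ having $\{\mathbb R\setminus K:K\in\mathscr K\}$ as a subbase of open sets. The poset $P$. Let $\mathcal C$ be the set of nonempty $\tau$-closed subsets of $\mathbb R$. For $C\in\mathcal C$ let $E_C=[\mathbb R\setminus C]^{\le\omega}$. Let $P=\{(C,\Lambda):C\in\mathcal C,\ \Lambda\subseteq E_C\}$, ordered by $(C,\Lambda)\le(D,\Gamma)$ iff $D\subseteq C$ and $\Lambda\subseteq\Gamma$. Scott topology. A nonempty subset $D$ of a poset is directed if any two elements of $D$ have an upper bound in $D$. The Scott topology on a poset consists of the upper sets $U$ such that whenever $D$ is directed, has a supremum, and $\bigvee D\in U$, then $D\cap U\ne\varnothing$. A space is sober if every irreducible closed subset is the closure of a unique point. *)

theory Defs
  imports "HOL-Analysis.Analysis" "HOL-Algebra.Order"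
begin

(* Orders are HOL-Algebra records with a carrier; its notation for the closure with respect to
   an equivalence would make the topological X closure_of S ambiguous. *)
no_notation eq_closure_of (\<open>closure'_of\<index>\<close>)

section \<open>Sober spaces\<close>

definition irreducible_closedin :: "'a topology \<Rightarrow> 'a set \<Rightarrow> bool" where
  "irreducible_closedin X C \<longleftrightarrow>
     closedin X C \<and> C \<noteq> {} \<and>
     (\<forall>A B. closedin X A \<and> closedin X B \<and> C = A \<union> B \<longrightarrow> C = A \<or> C = B)"

definition sober_space :: "'a topology \<Rightarrow> bool" where
  "sober_space X \<longleftrightarrow>
     (\<forall>C. irreducible_closedin X C \<longrightarrow> (\<exists>!x. x \<in> topspace X \<and> C = X closure_of {x}))"


section \<open>The Scott topology of a poset\<close>

definition directed_in :: "('a, 'b) gorder_scheme \<Rightarrow> 'a set \<Rightarrow> bool" where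
  "directed_in L D \<longleftrightarrow>
     D \<subseteq> carrier L \<and> D \<noteq> {} \<and>
     (\<forall>x\<in>D. \<forall>y\<in>D. \<exists>z\<in>D. x \<sqsubseteq>\<^bsub>L\<^esub> z \<and> y \<sqsubseteq>\<^bsub>L\<^esub> z)"

definition scott_open :: "('a, 'b) gorder_scheme \<Rightarrow> 'a set \<Rightarrow> bool" where
  "scott_open L U \<longleftrightarrow>
     U \<subseteq> carrier L \<and>
     (\<forall>x\<in>U. \<forall>y\<in>carrier L. x \<sqsubseteq>\<^bsub>L\<^esub> y \<longrightarrow> y \<in> U) \<and>
     (\<forall>D s. directed_in L D \<and> is_lub L s D \<and> s \<in> U \<longrightarrow> D \<inter> U \<noteq> {})"

definition scott_topology :: "('a, 'b) gorder_scheme \<Rightarrow> 'a topology" where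
  "scott_topology L = topology (scott_open L)"

lemma istopology_scott_open: "istopology (scott_open L)"
  unfolding istopology_def
proof (intro conjI allI impI)
  fix U V
  assume U: "scott_open L U" and V: "scott_open L V"
  have "D \<inter> (U \<inter> V) \<noteq> {}"
    if D: "directed_in L D" and s: "is_lub L s D" "s \<in> U \<inter> V" for D s
  proof -
    obtain x y where xy: "x \<in> D" "x \<in> U" "y \<in> D" "y \<in> V"
      using U V D s unfolding scott_open_def by blast
    then obtain z where z: "z \<in> D" "x \<sqsubseteq>\<^bsub>L\<^esub> z" "y \<sqsubseteq>\<^bsub>L\<^esub> z"
      using D unfolding directed_in_def by blast
    moreover have "z \<in> carrier L"
      using z(1) D unfolding directed_in_def by blast
    ultimately have "z \<in> U" "z \<in> V"
      using U V xy unfolding scott_open_def by blast+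
    then show ?thesis
      using z(1) by blast
  qed
  then show "scott_open L (U \<inter> V)"
    using U V unfolding scott_open_def by blast
next
  fix \<K>
  assume \<K>: "\<forall>K\<in>\<K>. scott_open L K"
  show "scott_open L (\<Union>\<K>)"
    unfolding scott_open_def
  proof (intro conjI ballI allI impI)
    show "\<Union>\<K> \<subseteq> carrier L"
      using \<K> by (auto simp: scott_open_def)
  next
    fix x y assume "x \<in> \<Union>\<K>" "y \<in> carrier L" "x \<sqsubseteq>\<^bsub>L\<^esub> y"
    then obtain K where "K \<in> \<K>" "y \<in> K"
      using \<K> unfolding scott_open_def by (metis UnionE)
    then show "y \<in> \<Union>\<K>" by (rule UnionI)
  next
    fix D s assume D: "directed_in L D \<and> is_lub L s D \<and> s \<in> \<Union>\<K>"
    then obtain K where K: "K \<in> \<K>" "s \<in> K" by auto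
    then have "D \<inter> K \<noteq> {}"
      using \<K> D unfolding scott_open_def by metis
    then show "D \<inter> \<Union>\<K> \<noteq> {}"
      using K(1) by auto
  qed
qed

lemma openin_scott_topology: "openin (scott_topology L) U \<longleftrightarrow> scott_open L U"
  by (simp add: scott_topology_def topology_inverse' istopology_scott_open)

lemma topspace_scott_topology: "topspace (scott_topology L) = carrier L"
proof -
  have "scott_open L (carrier L)"
    by (auto simp: scott_open_def directed_in_def)
  then show ?thesis
    unfolding topspace_def openin_scott_topology by (auto simp: scott_open_def)
qed


section \<open>The detector family\<close>

definition detector_family :: "real set set \<Rightarrow> bool" where
  "detector_family \<A> \<longleftrightarrow>
     (\<forall>A\<in>\<A>. countable A \<and> infinite A) \<and>
     \<A> \<approx> (UNIV :: real set) \<and>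
     pairwise (\<lambda>A B. finite (A \<inter> B)) \<A> \<and>
     (\<forall>B. uncountable B \<longrightarrow> (\<exists>A\<in>\<A>. A \<subseteq> B))"

(* Finite binary sequences are bool lists, so that map \<xi> [0..<n] is the restriction of \<xi> to its
   first n coordinates; f is the injection e_A attached to a member A of the family. *)
definition branch_set :: "(bool list \<Rightarrow> real) \<Rightarrow> (nat \<Rightarrow> bool) \<Rightarrow> real set" where
  "branch_set f \<xi> = {f (map \<xi> [0..<n]) | n. True}"

definition detectors ::
  "real set set \<Rightarrow> (real set \<Rightarrow> bool list \<Rightarrow> real) \<Rightarrow> (real \<Rightarrow> nat \<Rightarrow> bool) \<Rightarrow> real \<Rightarrow> real set set" where
  "detectors \<A> e \<beta> p = {branch_set (e A) (\<beta> p) - {p} | A. A \<in> \<A>}"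


section \<open>The topology on the reals\<close>

definition subbasic_closed ::
  "real set set \<Rightarrow> (real set \<Rightarrow> bool list \<Rightarrow> real) \<Rightarrow> (real \<Rightarrow> nat \<Rightarrow> bool) \<Rightarrow> real set set" where
  "subbasic_closed \<A> e \<beta> =
     {UNIV} \<union> {{x} | x. True} \<union>
     {{p} \<union> (S - F) | p S F. S \<in> detectors \<A> e \<beta> p \<and> finite F \<and> F \<subseteq> S}"

definition detector_topology ::
  "real set set \<Rightarrow> (real set \<Rightarrow> bool list \<Rightarrow> real) \<Rightarrow> (real \<Rightarrow> nat \<Rightarrow> bool) \<Rightarrow> real topology" where
  "detector_topology \<A> e \<beta> = topology_generated_by {UNIV - K | K. K \<in> subbasic_closed \<A> e \<beta>}"

(* topology_generated_by takes the union of the subbase as the underlying space. *)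
lemma topspace_detector_topology: "topspace (detector_topology \<A> e \<beta>) = UNIV"
proof -
  have "x \<in> \<Union>{UNIV - K | K. K \<in> subbasic_closed \<A> e \<beta>}" for x
  proof (rule UnionI)
    have "{x + 1} \<in> subbasic_closed \<A> e \<beta>"
      by (simp add: subbasic_closed_def)
    then show "UNIV - {x + 1} \<in> {UNIV - K | K. K \<in> subbasic_closed \<A> e \<beta>}"
      by (intro CollectI exI[of _ "{x + 1}"] conjI refl)
  qed simp
  then show ?thesis
    unfolding detector_topology_def topology_generated_by_topspace by (intro UNIV_eq_I[symmetric])
qed


section \<open>The poset\<close>

definition detector_poset ::
  "real set set \<Rightarrow> (real set \<Rightarrow> bool list \<Rightarrow> real) \<Rightarrow> (real \<Rightarrow> nat \<Rightarrow> bool) \<Rightarrow>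
     (real set \<times> real set set) gorder" where
  "detector_poset \<A> e \<beta> =
     \<lparr> carrier = {(C, \<Lambda>). closedin (detector_topology \<A> e \<beta>) C \<and> C \<noteq> {} \<and>
                          \<Lambda> \<subseteq> {E. E \<subseteq> UNIV - C \<and> countable E}},
       eq = (=),
       le = (\<lambda>(C, \<Lambda>) (D, \<Gamma>). D \<subseteq> C \<and> \<Lambda> \<subseteq> \<Gamma>) \<rparr>"

lemma partial_order_detector_poset: "partial_order (detector_poset \<A> e \<beta>)"
  by unfold_locales (auto simp: detector_poset_def)

end

theory Submission
  imports Defs
begin

text \<open>
  The whole poset is an irreducible closed set, yet it has no greatest element and so is not the
  closure of a point. For irreducibility, let a Scott open set \<open>U\<close> be nonempty, so that it
  contains a maximal element \<open>({p}, E)\<close>, where \<open>E\<close> consists of all countable sets avoiding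
  \<open>p\<close>. As \<open>E\<close> is the directed union of its finite subsets, \<open>U\<close> contains \<open>({p}, \<Lambda>)\<close> for some
  finite \<open>\<Lambda>\<close>, and \<open>\<Union>\<Lambda>\<close> is countable. If uncountably many \<open>q\<close> had their maximal element
  outside \<open>U\<close>, then some detector \<open>S\<close> at \<open>p\<close> would consist of such points and avoid \<open>\<Union>\<Lambda>\<close>.
  Since \<open>{p}\<close> is the filtered intersection of the closed sets \<open>{p} \<union> (S - F)\<close> with
  \<open>F\<close> finite, \<open>U\<close> contains one of the elements \<open>({p} \<union> (S - F), \<Lambda>)\<close>, hence the maximal element
  at a point of \<open>S - F\<close>, a contradiction. So \<open>U\<close> contains the maximal elements at all but
  countably many points, and any two nonempty open sets meet.
\<close>

text \<open>The complements of two closed sets covering the space are disjoint and open, so one of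
  them is empty.\<close>

lemma irreducible_closedin_topspace:
  assumes "topspace X \<noteq> {}"
    and meet: "\<And>U V. openin X U \<Longrightarrow> openin X V \<Longrightarrow> U \<noteq> {} \<Longrightarrow> V \<noteq> {} \<Longrightarrow> U \<inter> V \<noteq> {}"
  shows "irreducible_closedin X (topspace X)"
  unfolding irreducible_closedin_def
proof (intro conjI allI impI)
  fix A B
  assume AB: "closedin X A \<and> closedin X B \<and> topspace X = A \<union> B"
  then have "(topspace X - A) \<inter> (topspace X - B) = {}" by auto
  then have "topspace X - A = {} \<or> topspace X - B = {}"
    using meet[of "topspace X - A" "topspace X - B"] AB by blast
  then show "topspace X = A \<or> topspace X = B"
    using AB by auto
qed (use assms in auto)

text \<open>A directed set lying entirely below \<open>x\<close> has \<open>x\<close> as an upper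
  bound, so its supremum is below \<open>x\<close> as well.\<close>

lemma scott_open_not_le:
  assumes "x \<in> carrier L" and "partial_order L"
  shows "scott_open L {y \<in> carrier L. \<not> y \<sqsubseteq>\<^bsub>L\<^esub> x}"
proof -
  interpret partial_order L by fact
  let ?U = "{y \<in> carrier L. \<not> y \<sqsubseteq>\<^bsub>L\<^esub> x}"
  show ?thesis
    unfolding scott_open_def
  proof (intro conjI ballI allI impI)
    fix y z assume "y \<in> ?U" "z \<in> carrier L" "y \<sqsubseteq>\<^bsub>L\<^esub> z"
    then show "z \<in> ?U"
      using le_trans[of y z x] assms(1) by auto
  next
    fix D s assume D: "directed_in L D \<and> is_lub L s D \<and> s \<in> ?U"
    then have "D \<subseteq> carrier L"
      by (simp add: directed_in_def)
    show "D \<inter> ?U \<noteq> {}"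
    proof
      assume "D \<inter> ?U = {}"
      then have "x \<in> Upper L D"
        using \<open>D \<subseteq> carrier L\<close> assms(1) unfolding Upper_def by blast
      then show False
        using D unfolding least_def by blast
    qed
  qed simp
qed

text \<open>By the previous lemma, a point not below \<open>x\<close> has an open neighbourhood
  missing \<open>x\<close>. A point whose closure is the whole poset is therefore a greatest
  element.\<close>

lemma scott_closure_of_singleton_le:
  assumes "x \<in> carrier L" and "partial_order L" and "y \<in> scott_topology L closure_of {x}"
  shows "y \<sqsubseteq>\<^bsub>L\<^esub> x"
proof (rule ccontr)
  interpret partial_order L by fact
  let ?U = "{y \<in> carrier L. \<not> y \<sqsubseteq>\<^bsub>L\<^esub> x}"
  assume "\<not> y \<sqsubseteq>\<^bsub>L\<^esub> x"
  moreover have "y \<in> carrier L"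
    using assms(3) closure_of_subset_topspace[of "scott_topology L" "{x}"]
    unfolding topspace_scott_topology by (rule set_mp[rotated])
  ultimately have "y \<in> ?U" by simp
  moreover have "openin (scott_topology L) ?U"
    unfolding openin_scott_topology using assms(1,2) by (rule scott_open_not_le)
  ultimately obtain z where "z \<in> {x}" "z \<in> ?U"
    using assms(3) unfolding in_closure_of by metis
  then show False
    using assms(1) by simp
qed

lemma infinite_branch_set:
  assumes "inj f"
  shows "infinite (branch_set f \<xi>)"
proof -
  \<comment> \<open>The length of a restriction recovers \<open>n\<close>.\<close>
  have "inj (\<lambda>n. f (map \<xi> [0..<n]))"
    using assms by (auto intro!: injI dest!: injD dest: arg_cong[of _ _ length])
  moreover have "branch_set f \<xi> = range (\<lambda>n. f (map \<xi> [0..<n]))"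
    by (auto simp: branch_set_def)
  ultimately show ?thesis
    by (simp add: range_inj_infinite)
qed

lemma closedin_detector_topology_subbasic:
  assumes "K \<in> subbasic_closed \<A> e \<beta>"
  shows "closedin (detector_topology \<A> e \<beta>) K"
  unfolding closedin_def topspace_detector_topology
  unfolding detector_topology_def
  using assms by (auto intro: topology_generated_by_Basis)

text \<open>These elements are maximal: a nonempty subset of \<open>{p}\<close> is
  \<open>{p}\<close> itself, and the second component is already as large as \<open>p\<close>
  allows.\<close>

definition max_elem :: "real \<Rightarrow> real set \<times> real set set" where
  "max_elem p = ({p}, {E. E \<subseteq> UNIV - {p} \<and> countable E})"

lemma singleton_in_detector_poset:
  "({p}, \<Lambda>) \<in> carrier (detector_poset \<A> e \<beta>) \<longleftrightarrow> (\<forall>E\<in>\<Lambda>. p \<notin> E \<and> countable E)"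
proof -
  have "closedin (detector_topology \<A> e \<beta>) {p}"
    by (rule closedin_detector_topology_subbasic) (auto simp: subbasic_closed_def)
  then show ?thesis
    by (auto simp: detector_poset_def)
qed

lemma max_elem_in_carrier: "max_elem p \<in> carrier (detector_poset \<A> e \<beta>)"
  by (auto simp: max_elem_def singleton_in_detector_poset)

lemma le_detector_poset:
  "(C, \<Lambda>) \<sqsubseteq>\<^bsub>detector_poset \<A> e \<beta>\<^esub> (D, \<Gamma>) \<longleftrightarrow> D \<subseteq> C \<and> \<Lambda> \<subseteq> \<Gamma>"
  by (simp add: detector_poset_def)

lemma le_max_elem:
  assumes "(C, \<Lambda>) \<in> carrier (detector_poset \<A> e \<beta>)" and "p \<in> C"
  shows "(C, \<Lambda>) \<sqsubseteq>\<^bsub>detector_poset \<A> e \<beta>\<^esub> max_elem p"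
  using assms by (auto simp: max_elem_def detector_poset_def)

lemma scott_open_finite_below_max_elem:
  assumes U: "scott_open (detector_poset \<A> e \<beta>) U" and p: "max_elem p \<in> U"
  obtains \<Lambda> where "finite \<Lambda>" "({p}, \<Lambda>) \<in> U"
proof -
  let ?P = "detector_poset \<A> e \<beta>"
  define E where "E = {E. E \<subseteq> UNIV - {p} \<and> countable E}"
  define D where "D = {({p}, \<Lambda>) | \<Lambda>. finite \<Lambda> \<and> \<Lambda> \<subseteq> E}"
  have D: "D \<subseteq> carrier ?P"
  proof
    fix x assume "x \<in> D"
    then obtain \<Lambda> where "x = ({p}, \<Lambda>)" "\<Lambda> \<subseteq> E"
      unfolding D_def by blast
    then show "x \<in> carrier ?P"
      unfolding E_def by (simp add: singleton_in_detector_poset) blast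
  qed
  have "directed_in ?P D"
    unfolding directed_in_def
  proof (intro conjI ballI)
    fix x y assume "x \<in> D" "y \<in> D"
    then obtain \<Lambda> \<Gamma> where xy: "x = ({p}, \<Lambda>)" "y = ({p}, \<Gamma>)"
      and fin: "finite \<Lambda>" "finite \<Gamma>" "\<Lambda> \<subseteq> E" "\<Gamma> \<subseteq> E"
      by (auto simp: D_def)
    then have "({p}, \<Lambda> \<union> \<Gamma>) \<in> D" by (auto simp: D_def)
    then show "\<exists>z\<in>D. x \<sqsubseteq>\<^bsub>?P\<^esub> z \<and> y \<sqsubseteq>\<^bsub>?P\<^esub> z"
      by (intro bexI[of _ "({p}, \<Lambda> \<union> \<Gamma>)"]) (auto simp: xy le_detector_poset)
  qed (use D in \<open>auto simp: D_def\<close>)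
  moreover have "is_lub ?P (max_elem p) D"
    unfolding least_def
  proof (intro conjI ballI)
    show "max_elem p \<in> Upper ?P D"
      using max_elem_in_carrier by (auto simp: Upper_def D_def max_elem_def le_detector_poset E_def)
  next
    fix y assume y: "y \<in> Upper ?P D"
    obtain C \<Gamma> where [simp]: "y = (C, \<Gamma>)" by (cases y)
    have "({p}, \<Lambda>) \<sqsubseteq>\<^bsub>?P\<^esub> y" if "finite \<Lambda>" "\<Lambda> \<subseteq> E" for \<Lambda>
    proof -
      have "({p}, \<Lambda>) \<in> D" using that by (auto simp: D_def)
      then show ?thesis using y D by (auto simp: Upper_def)
    qed
    \<comment> \<open>The empty family gives \<open>C \<subseteq> {p}\<close>; the one-element
      families put each member of \<open>E\<close> into \<open>\<Gamma>\<close>.\<close>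
    from this[of "{}"] this[of "{X}" for X] show "max_elem p \<sqsubseteq>\<^bsub>?P\<^esub> y"
      by (auto simp: le_detector_poset max_elem_def E_def)
  qed (auto simp: Upper_def)
  ultimately have "D \<inter> U \<noteq> {}"
    using U p unfolding scott_open_def by blast
  then show thesis
    using that by (auto simp: D_def)
qed

text \<open>Disjointness of \<open>S\<close> from \<open>\<Union>\<Lambda>\<close> keeps the family
  \<open>\<Lambda>\<close> admissible when \<open>{p}\<close> is enlarged by points of
  \<open>S\<close>.\<close>

lemma scott_open_detector_below_singleton:
  assumes U: "scott_open (detector_poset \<A> e \<beta>) U" and p: "({p}, \<Lambda>) \<in> U"
    and S: "S \<in> detectors \<A> e \<beta> p" "S \<inter> \<Union>\<Lambda> = {}"
  obtains F where "finite F" "({p} \<union> (S - F), \<Lambda>) \<in> U"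
proof -
  let ?P = "detector_poset \<A> e \<beta>"
  have pP: "({p}, \<Lambda>) \<in> carrier ?P"
    using U p unfolding scott_open_def by blast
  then have \<Lambda>: "\<forall>E\<in>\<Lambda>. p \<notin> E \<and> countable E"
    unfolding singleton_in_detector_poset .
  define D where "D = {({p} \<union> (S - F), \<Lambda>) | F. finite F \<and> F \<subseteq> S}"
  have "closedin (detector_topology \<A> e \<beta>) ({p} \<union> (S - F))" if "finite F" "F \<subseteq> S" for F
    by (rule closedin_detector_topology_subbasic) (use that S in \<open>auto simp: subbasic_closed_def\<close>)
  then have D: "D \<subseteq> carrier ?P"
    using \<Lambda> S(2) by (fastforce simp: D_def detector_poset_def)
  have "directed_in ?P D"
    unfolding directed_in_def
  proof (intro conjI ballI)
    fix x y assume "x \<in> D" "y \<in> D"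
    then obtain F G where xy: "x = ({p} \<union> (S - F), \<Lambda>)" "y = ({p} \<union> (S - G), \<Lambda>)"
      and fin: "finite F" "finite G" "F \<subseteq> S" "G \<subseteq> S"
      by (auto simp: D_def)
    then have "({p} \<union> (S - (F \<union> G)), \<Lambda>) \<in> D"
      unfolding D_def by blast
    then show "\<exists>z\<in>D. x \<sqsubseteq>\<^bsub>?P\<^esub> z \<and> y \<sqsubseteq>\<^bsub>?P\<^esub> z"
      by (rule bexI[rotated]) (auto simp: xy le_detector_poset)
  qed (use D in \<open>auto simp: D_def\<close>)
  moreover have "is_lub ?P ({p}, \<Lambda>) D"
    unfolding least_def
  proof (intro conjI ballI)
    show "({p}, \<Lambda>) \<in> Upper ?P D"
      using pP by (auto simp: Upper_def D_def le_detector_poset)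
  next
    fix y assume y: "y \<in> Upper ?P D"
    obtain C \<Gamma> where [simp]: "y = (C, \<Gamma>)" by (cases y)
    have "({p} \<union> (S - F), \<Lambda>) \<sqsubseteq>\<^bsub>?P\<^esub> y" if "finite F" "F \<subseteq> S" for F
    proof -
      have "({p} \<union> (S - F), \<Lambda>) \<in> D" using that by (auto simp: D_def)
      then show ?thesis using y D by (auto simp: Upper_def)
    qed
    \<comment> \<open>\<open>F = {}\<close> gives \<open>C \<subseteq> {p} \<union> S\<close> and
      \<open>\<Lambda> \<subseteq> \<Gamma>\<close>; \<open>F = {x}\<close> then excludes each
      \<open>x\<close> in \<open>S\<close> other than \<open>p\<close> from
      \<open>C\<close>.\<close>
    from this[of "{}"] this[of "{x}" for x] show "({p}, \<Lambda>) \<sqsubseteq>\<^bsub>?P\<^esub> y"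
      by (auto simp: le_detector_poset)
  qed (auto simp: Upper_def)
  ultimately have "D \<inter> U \<noteq> {}"
    using U p unfolding scott_open_def by blast
  then show thesis
    using that by (auto simp: D_def)
qed

lemma countable_max_elem_notin_scott_open:
  assumes \<A>: "detector_family \<A>"
    and e: "\<And>A. A \<in> \<A> \<Longrightarrow> inj (e A) \<and> range (e A) \<subseteq> A"
    and U: "scott_open (detector_poset \<A> e \<beta>) U" and "U \<noteq> {}"
  shows "countable {q. max_elem q \<notin> U}"
proof (rule ccontr)
  let ?P = "detector_poset \<A> e \<beta>"
  assume unc: "uncountable {q. max_elem q \<notin> U}"
  \<comment> \<open>Used twice: first to find some maximal element in \<open>U\<close>, and at the
    end to reach one that was assumed to lie outside.\<close>
  have up: "max_elem q \<in> U" if "(C, \<Lambda>) \<in> U" "q \<in> C" for C \<Lambda> q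
  proof -
    have "(C, \<Lambda>) \<in> carrier ?P"
      using U that(1) unfolding scott_open_def by blast
    then have "(C, \<Lambda>) \<sqsubseteq>\<^bsub>?P\<^esub> max_elem q"
      using that(2) by (rule le_max_elem)
    then show ?thesis
      using U that(1) max_elem_in_carrier[of q] unfolding scott_open_def by metis
  qed
  obtain C \<Lambda>' where C: "(C, \<Lambda>') \<in> U"
    using \<open>U \<noteq> {}\<close> by auto
  moreover have "(C, \<Lambda>') \<in> carrier ?P"
    using C U unfolding scott_open_def by blast
  then have "C \<noteq> {}"
    by (simp add: detector_poset_def)
  ultimately obtain p where "max_elem p \<in> U"
    using up by blast
  then obtain \<Lambda> where \<Lambda>: "finite \<Lambda>" "({p}, \<Lambda>) \<in> U"
    using scott_open_finite_below_max_elem[OF U] by blast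
  then have "({p}, \<Lambda>) \<in> carrier ?P"
    using U unfolding scott_open_def by blast
  then have "countable (\<Union>\<Lambda>)"
    using \<Lambda>(1) countable_UN[of \<Lambda> "\<lambda>E. E"]
    by (simp add: singleton_in_detector_poset countable_finite)
  \<comment> \<open>Discarding \<open>\<Union>\<Lambda>\<close> before choosing \<open>A\<close>
    makes every detector inside \<open>A\<close> avoid it.\<close>
  then have "uncountable ({q. max_elem q \<notin> U} - \<Union>\<Lambda>)"
    using unc uncountable_minus_countable by blast
  then obtain A where A: "A \<in> \<A>" "A \<subseteq> {q. max_elem q \<notin> U} - \<Union>\<Lambda>"
    using \<A> unfolding detector_family_def by blast
  define S where "S = branch_set (e A) (\<beta> p) - {p}"
  have S: "S \<in> detectors \<A> e \<beta> p"
    using A(1) by (auto simp: S_def detectors_def)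
  have "infinite S"
    unfolding S_def using infinite_branch_set e[OF A(1)] by simp
  have "S \<subseteq> A"
    using e[OF A(1)] by (auto simp: S_def branch_set_def)
  then have "S \<inter> \<Union>\<Lambda> = {}"
    using A(2) by blast
  with U \<Lambda>(2) S obtain F where F: "finite F" "({p} \<union> (S - F), \<Lambda>) \<in> U"
    by (rule scott_open_detector_below_singleton)
  obtain q where q: "q \<in> S - F"
    using \<open>infinite S\<close> F(1) by (metis Diff_infinite_finite all_not_in_conv finite.emptyI)
  then have "max_elem q \<in> U"
    using up[OF F(2)] by blast
  then show False
    using q \<open>S \<subseteq> A\<close> A(2) by blast
qed

theorem corollary6p4:
  fixes \<A> :: "real set set"
    and e :: "real set \<Rightarrow> bool list \<Rightarrow> real"
    and \<beta> :: "real \<Rightarrow> nat \<Rightarrow> bool"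
  assumes "detector_family \<A>"
    and "\<And>A. A \<in> \<A> \<Longrightarrow> inj (e A) \<and> range (e A) \<subseteq> A"
    and "bij \<beta>"
  shows "\<not> sober_space (scott_topology (detector_poset \<A> e \<beta>))"
proof
  let ?P = "detector_poset \<A> e \<beta>"
  let ?X = "scott_topology ?P"
  assume sober: "sober_space ?X"
  have "irreducible_closedin ?X (topspace ?X)"
  proof (rule irreducible_closedin_topspace)
    show "topspace ?X \<noteq> {}"
      using max_elem_in_carrier unfolding topspace_scott_topology by fast
  next
    fix U V assume UV: "openin ?X U" "openin ?X V" "U \<noteq> {}" "V \<noteq> {}"
    then have "countable ({q. max_elem q \<notin> U} \<union> {q. max_elem q \<notin> V})"
      using countable_max_elem_notin_scott_open[OF assms(1,2)]
      by (simp add: openin_scott_topology)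
    \<comment> \<open>Any real outside both exceptional sets gives a maximal element common to
      \<open>U\<close> and \<open>V\<close>.\<close>
    then have "{q. max_elem q \<notin> U} \<union> {q. max_elem q \<notin> V} \<noteq> UNIV"
      using uncountable_UNIV_real by metis
    then show "U \<inter> V \<noteq> {}" by blast
  qed
  then obtain x where x: "x \<in> carrier ?P" "carrier ?P = ?X closure_of {x}"
    using sober unfolding sober_space_def topspace_scott_topology by blast
  have le: "max_elem p \<sqsubseteq>\<^bsub>?P\<^esub> x" for p
    using scott_closure_of_singleton_le[OF x(1) partial_order_detector_poset]
      max_elem_in_carrier x(2) by blast
  obtain C \<Lambda> where x_eq: "x = (C, \<Lambda>)" by (cases x)
  \<comment> \<open>A greatest element would need its first component inside every singleton; two
    distinct reals already force it to be empty.\<close>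
  have "C \<subseteq> {p}" for p
    using le[of p] by (simp add: x_eq max_elem_def le_detector_poset)
  from this[of 0] this[of 1] have "C = {}"
    by force
  then show False
    using x(1) by (simp add: x_eq detector_poset_def)
qed

end
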